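(* The topological group $\mathrm{Diff}_+^1(I)$ is quasi-isometric to $C[0,1]^\#=\{F\in C[0,1]:F(0)=0\}$ (viewed as a Banach space with the supremum-norm metric) via the mapping $\Phi_1:\mathrm{Diff}_+^1(I)\to C[0,1]^\#$, $\Phi_1(f)=\log f'-\log f'(0)$. That is, $\Phi_1$ is a quasi-isometry from $\mathrm{Diff}_+^1(I)$, equipped with any metric representing its quasi-isometry class as a topological group, to $C[0,1]^\#$ with its norm metric.
   Context: $I=[0,1]$. $\mathrm{Diff}_+^1(I)$ is the group (under composition) of orientation-preserving $C^1$-diffeomorphisms of $I$ with the topology induced by $\rho_1(f,g)=\sup_{x\in I}|f(x)-g(x)|+\sup_{x\in I}|f'(x)-g'(x)|$. $C[0,1]$ is the space of real-valued continuous functions on $[0,1]$ with the supremum norm. A subset $\Sigma$ of a separable metrizable group $G$ has the property (OB) relative to $G$ if $\Sigma$ has finite diameter with respect to every right-invariant metric on $G$ compatible with the topology of $G$. (For a connected Polish group $G$, such as $\mathrm{Diff}_+^1(I)$, this is equivalent to: for every open neighborhood $U$ of the identity there is a positive integer $r$ with $\Sigma\subseteq U^r$.) If $G$ is generated by an open subset with the property (OB) relative to $G$ (which is the case for $\mathrm{Diff}_+^1(I)$), the quasi-isometry class of $G$ as a topological group is represented by the right Cayley metrics $d_\Sigma(f,g)=\min\{n\geq 0: fg^{-1}\in\Sigma^n\}$ (with $\Sigma^0=\{e\}$), where $\Sigma$ is an open symmetric generating set with the property (OB) relative to $G$; by results of Rosendal these are mutually quasi-isometric via the identity map. A metric on $G$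 represents this class if the identity map of $G$ is a quasi-isometry between it and such a $d_\Sigma$. A map $\phi:(X,d_X)\to(Y,d_Y)$ of metric spaces is a quasi-isometry if there are $L\geq1$, $C\geq0$ with $\frac1L d_X(x,x')-C\leq d_Y(\phi(x),\phi(x'))\leq L d_X(x,x')+C$ for all $x,x'\in X$ and every point of $Y$ is within distance $C$ of $\phi(X)$. *)

theory Defs
  imports "HOL-Analysis.Analysis" "HOL-Algebra.Generated_Groups"
begin

section \<open>Quasi-isometries\<close>

definition quasi_isometry ::
  "'a set \<Rightarrow> ('a \<Rightarrow> 'a \<Rightarrow> real) \<Rightarrow> 'b set \<Rightarrow> ('b \<Rightarrow> 'b \<Rightarrow> real) \<Rightarrow> ('a \<Rightarrow> 'b) \<Rightarrow> bool" where
  "quasi_isometry X dX Y dY \<phi> \<longleftrightarrow>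
     \<phi> ` X \<subseteq> Y \<and>
     (\<exists>L C. L \<ge> 1 \<and> C \<ge> 0 \<and>
        (\<forall>x\<in>X. \<forall>x'\<in>X. 1 / L * dX x x' - C \<le> dY (\<phi> x) (\<phi> x') \<and>
                      dY (\<phi> x) (\<phi> x') \<le> L * dX x x' + C) \<and>
        (\<forall>y\<in>Y. \<exists>x\<in>X. dY y (\<phi> x) \<le> C))"


section \<open>Coarse geometry of topological groups\<close>

text \<open>
  A topological group is given by a group \<open>G\<close> of HOL-Algebra together with a topology \<open>T\<close>
  on its carrier.
\<close>

definition right_invariant_compatible_metric ::
  "('a, 'b) monoid_scheme \<Rightarrow> 'a topology \<Rightarrow> ('a \<Rightarrow> 'a \<Rightarrow> real) \<Rightarrow> bool" where
  "right_invariant_compatible_metric G T d \<longleftrightarrow>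
     Metric_space (carrier G) d \<and>
     Metric_space.mtopology (carrier G) d = T \<and>
     (\<forall>x\<in>carrier G. \<forall>y\<in>carrier G. \<forall>z\<in>carrier G. d (x \<otimes>\<^bsub>G\<^esub> z) (y \<otimes>\<^bsub>G\<^esub> z) = d x y)"

definition property_OB ::
  "('a, 'b) monoid_scheme \<Rightarrow> 'a topology \<Rightarrow> 'a set \<Rightarrow> bool" where
  "property_OB G T \<Sigma> \<longleftrightarrow>
     \<Sigma> \<subseteq> carrier G \<and>
     (\<forall>d. right_invariant_compatible_metric G T d \<longrightarrow> Metric_space.mbounded (carrier G) d \<Sigma>)"

primrec set_power :: "('a, 'b) monoid_scheme \<Rightarrow> 'a set \<Rightarrow> nat \<Rightarrow> 'a set" where
  "set_power G \<Sigma> 0 = {\<one>\<^bsub>G\<^esub>}"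
| "set_power G \<Sigma> (Suc n) = set_power G \<Sigma> n <#>\<^bsub>G\<^esub> \<Sigma>"

definition open_symmetric_OB_generating ::
  "('a, 'b) monoid_scheme \<Rightarrow> 'a topology \<Rightarrow> 'a set \<Rightarrow> bool" where
  "open_symmetric_OB_generating G T \<Sigma> \<longleftrightarrow>
     openin T \<Sigma> \<and>
     (\<forall>x\<in>\<Sigma>. inv\<^bsub>G\<^esub> x \<in> \<Sigma>) \<and>
     generate G \<Sigma> = carrier G \<and>
     property_OB G T \<Sigma>"

text \<open>Only meaningful on the carrier of \<open>G\<close> and for a symmetric generating set \<open>\<Sigma>\<close>.\<close>

definition right_cayley_metric ::
  "('a, 'b) monoid_scheme \<Rightarrow> 'a set \<Rightarrow> 'a \<Rightarrow> 'a \<Rightarrow> real" where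
  "right_cayley_metric G \<Sigma> f g = real (LEAST n. f \<otimes>\<^bsub>G\<^esub> inv\<^bsub>G\<^esub> g \<in> set_power G \<Sigma> n)"

text \<open>No compatibility of \<open>d\<close> with \<open>T\<close> is required here: the Cayley metrics themselves are discrete.\<close>

definition represents_quasi_isometry_class ::
  "('a, 'b) monoid_scheme \<Rightarrow> 'a topology \<Rightarrow> ('a \<Rightarrow> 'a \<Rightarrow> real) \<Rightarrow> bool" where
  "represents_quasi_isometry_class G T d \<longleftrightarrow>
     Metric_space (carrier G) d \<and>
     (\<exists>\<Sigma>. open_symmetric_OB_generating G T \<Sigma> \<and>
          quasi_isometry (carrier G) (right_cayley_metric G \<Sigma>) (carrier G) d (\<lambda>x. x))"


section \<open>Orientation-preserving \<open>C\<^sup>1\<close>-diffeomorphisms of the unit interval\<close>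

text \<open>One-sided derivatives at the end points.\<close>

definition deriv_I :: "(real \<Rightarrow> real) \<Rightarrow> real \<Rightarrow> real" where
  "deriv_I f x = vector_derivative f (at x within {0..1})"

definition C1_on_I :: "(real \<Rightarrow> real) \<Rightarrow> bool" where
  "C1_on_I f \<longleftrightarrow>
     (\<forall>x\<in>{0..1}. (f has_real_derivative deriv_I f x) (at x within {0..1})) \<and>
     continuous_on {0..1} (deriv_I f)"

text \<open>
  Maps of the unit interval are represented by functions that are \<^term>\<open>undefined\<close> outside of it,
  so that equality of maps is equality of functions.
\<close>

definition Diff1 :: "(real \<Rightarrow> real) set" where
  "Diff1 = {f \<in> extensional {0..1}.
      bij_betw f {0..1} {0..1} \<and> C1_on_I f \<and> C1_on_I (inv_into {0..1} f) \<and>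
      strict_mono_on {0..1} f}"

definition Diff1_group :: "(real \<Rightarrow> real) monoid" where
  "Diff1_group =
     \<lparr>carrier = Diff1, mult = compose {0..1}, one = restrict (\<lambda>x. x) {0..1}\<rparr>"

text \<open>The locale \<^locale>\<open>Metric_space\<close> demands nonnegativity on the whole type, hence the value 0
  outside of \<^const>\<open>Diff1\<close>.\<close>

definition rho1 :: "(real \<Rightarrow> real) \<Rightarrow> (real \<Rightarrow> real) \<Rightarrow> real" where
  "rho1 f g =
     (if f \<in> Diff1 \<and> g \<in> Diff1
      then (SUP x\<in>{0..1}. \<bar>f x - g x\<bar>) + (SUP x\<in>{0..1}. \<bar>deriv_I f x - deriv_I g x\<bar>)
      else 0)"

definition Diff1_topology :: "(real \<Rightarrow> real) topology" where
  "Diff1_topology = Metric_space.mtopology Diff1 rho1"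


section \<open>The target space and the map\<close>

text \<open>
  \<^const>\<open>cfunspace\<close> carries the supremum metric; its elements are again \<^term>\<open>undefined\<close> outside
  of the unit interval.
\<close>

definition C_sharp :: "(real \<Rightarrow> real) metric" where
  "C_sharp = submetric (cfunspace (top_of_set {0..1}) euclidean_metric) {F. F 0 = 0}"

definition Phi1 :: "(real \<Rightarrow> real) \<Rightarrow> real \<Rightarrow> real" where
  "Phi1 f = (\<lambda>x\<in>{0..1}. ln (deriv_I f x) - ln (deriv_I f 0))"

end

theory Submission
  imports Defs
begin

text \<open>
  The chain rule makes \<^const>\<open>Phi1\<close> a cocycle: since \<open>g 0 = 0\<close>,
  \<open>Phi1 (f \<circ> g) = Phi1 f \<circ> g + Phi1 g\<close> (\<open>Phi1_compose\<close>). As \<open>g\<close> permutes the interval, the pulled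
  back metric \<open>\<delta> f g = \<parallel>Phi1 f - Phi1 g\<parallel>\<close> is therefore right-invariant
  (\<open>Phi1_metric_right_invariant\<close>). It is also compatible with the \<open>C\<^sup>1\<close> topology
  (\<open>Diff1_topology_eq_Phi1\<close>), and \<^const>\<open>Phi1\<close> maps onto the whole Banach space, because
  \<open>x \<mapsto> \<integral>\<^sub>0\<^sup>x exp F / \<integral>\<^sub>0\<^sup>1 exp F\<close> is a preimage of \<open>F\<close> (\<open>Phi1_surj\<close>).

  Hence \<^const>\<open>Phi1\<close> is an isometry from \<open>\<delta>\<close> onto the target, and the whole theorem reduces to showing
  that \<open>\<delta>\<close> represents the quasi-isometry class of the group. This follows from one more property
  that \<open>\<delta>\<close> inherits from the norm: the segment \<open>t \<cdot> Phi1 f\<close> lifts to a geodesic from the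
  identity to \<open>f\<close> (\<open>Phi1_metric_subdivide\<close>). Cutting it into \<open>n\<close> equal pieces writes \<open>f\<close> as a
  product of \<open>n\<close> elements of length \<open>\<delta> f 1 / n\<close>, so a ball of radius \<open>n \<epsilon>\<close> lies in the \<open>n\<close>-th power
  of the ball of radius \<open>\<epsilon>\<close>.

  The rest is a fact about any group with such a metric. Each ball is bounded for every
  right-invariant compatible metric, so the open unit ball is a generating set with property (OB)
  (\<open>open_symmetric_OB_generating_mball\<close>). Conversely, a generating set \<open>\<Sigma>\<close> with property (OB) is
  \<open>\<delta>\<close>-bounded, which bounds \<open>\<delta>\<close> by word length, while \<open>\<Sigma>\<^sup>2\<close> contains a ball about the identity,
  which bounds word length by \<open>\<delta>\<close> (\<open>cayley_metric_bounds\<close>).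
\<close>

section \<open>Powers of subsets of a group\<close>

context group begin

lemma set_power_closed: "V \<subseteq> carrier G \<Longrightarrow> set_power G V n \<subseteq> carrier G"
  by (induction n) (auto simp: set_mult_closed)

lemma set_power_add:
  assumes "V \<subseteq> carrier G"
  shows "set_power G V (m + n) = set_power G V m <#> set_power G V n"
proof (induction n)
  case 0
  show ?case
    using set_power_closed[OF assms, of m] by (force simp: set_mult_def)
next
  case (Suc n)
  then show ?case
    using assms by (simp add: set_mult_assoc set_power_closed)
qed

lemma set_power_1: "V \<subseteq> carrier G \<Longrightarrow> set_power G V (Suc 0) = V"
  by (force simp: set_mult_def)

lemma set_power_mult:
  assumes "V \<subseteq> carrier G"
  shows "set_power G (set_power G V m) n = set_power G V (m * n)"
  by (induction n) (simp_all add: set_power_add[OF assms, symmetric] add.commute)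

lemma generate_subset_set_powers:
  assumes V: "V \<subseteq> carrier G" and sym: "\<And>x. x \<in> V \<Longrightarrow> inv x \<in> V"
  shows "generate G V \<subseteq> (\<Union>n. set_power G V n)"
proof
  fix x assume "x \<in> generate G V"
  then show "x \<in> (\<Union>n. set_power G V n)"
  proof induction
    case one
    have "\<one> \<in> set_power G V 0" by simp
    then show ?case by blast
  next
    case (incl h)
    then show ?case using set_power_1[OF V] by blast
  next
    case (inv h)
    then show ?case using set_power_1[OF V] sym by blast
  next
    case (eng h k)
    then obtain m n where "h \<in> set_power G V m" "k \<in> set_power G V n" by blast
    then have "h \<otimes> k \<in> set_power G V (m + n)"
      by (auto simp: set_power_add[OF V] set_mult_def)
    then show ?case by blast
  qed
qed

lemma set_power_subset_generate: "set_power G V n \<subseteq> generate G V"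
  by (induction n) (auto simp: set_mult_def intro: generate.intros)

end

section \<open>Right-invariant metrics on groups\<close>

locale right_invariant_metric_group = group G + Metric_space "carrier G" d
  for G (structure) and d +
  assumes right_invariant:
    "\<lbrakk>x \<in> carrier G; y \<in> carrier G; z \<in> carrier G\<rbrakk> \<Longrightarrow> d (x \<otimes> z) (y \<otimes> z) = d x y"
begin

lemma dist_mult_inv:
  assumes "x \<in> carrier G" "y \<in> carrier G"
  shows "d (x \<otimes> inv y) \<one> = d x y"
  using right_invariant[of x y "inv y"] assms by simp

lemma dist_inv:
  assumes "x \<in> carrier G"
  shows "d (inv x) \<one> = d x \<one>"
  using dist_mult_inv[of \<one> x] assms by (simp add: commute)

lemma dist_mult_le:
  assumes "x \<in> carrier G" "y \<in> carrier G"
  shows "d (x \<otimes> y) \<one> \<le> d x \<one> + d y \<one>"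
  using triangle[of "x \<otimes> y" y \<one>] right_invariant[of x \<one> y] assms by simp

lemma dist_set_power_le:
  assumes V: "V \<subseteq> carrier G" "\<And>v. v \<in> V \<Longrightarrow> d v \<one> \<le> R"
    and x: "x \<in> set_power G V n"
  shows "d x \<one> \<le> real n * R"
  using x
proof (induction n arbitrary: x)
  case (Suc n)
  then obtain y v where x: "x = y \<otimes> v" and y: "y \<in> set_power G V n" and v: "v \<in> V"
    by (auto simp: set_mult_def)
  have "d x \<one> \<le> d y \<one> + d v \<one>"
    unfolding x using y v V(1) set_power_closed by (blast intro: dist_mult_le)
  with Suc.IH[OF y] V(2)[OF v] show ?case by (simp add: algebra_simps)
qed simp

lemma mball_translate:
  assumes "s \<in> carrier G" "x \<in> mball \<one> r"
  shows "x \<otimes> s \<in> mball s r"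
  using assms right_invariant[of \<one> x s] by simp

end

section \<open>Groups with a geodesic right-invariant metric\<close>

text \<open>
  The point \<open>y\<close> divides a geodesic from the identity to \<open>x\<close> in the ratio \<open>t : 1 - t\<close>; by the
  triangle inequality both estimates are in fact equalities.
\<close>

locale geodesic_metric_group = right_invariant_metric_group +
  assumes subdivide:
    "\<lbrakk>x \<in> carrier G; 0 \<le> t; t \<le> 1\<rbrakk> \<Longrightarrow>
      \<exists>y\<in>carrier G. d y \<one> \<le> t * d x \<one> \<and> d x y \<le> (1 - t) * d x \<one>"
begin

text \<open>
  Subdivision: peel off the point at parameter \<open>1 / (n + 1)\<close> of a geodesic from the identity to \<open>x\<close>.
  It lies in the small ball, and by right invariance the remaining factor has length at most
  \<open>n \<epsilon>\<close>. Closed balls make the base case \<open>n = 0\<close> true.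
\<close>

lemma mcball_subset_set_power:
  assumes V: "mcball \<one> \<epsilon> \<subseteq> V" and "0 < \<epsilon>"
  shows "mcball \<one> (real n * \<epsilon>) \<subseteq> set_power G V n"
proof (induction n)
  case 0
  have "x = \<one>" if "x \<in> mcball \<one> 0" for x
    using that nonneg[of \<one> x] zero[of \<one> x] by auto
  then show ?case by auto
next
  case (Suc n)
  show ?case
  proof
    fix x assume "x \<in> mcball \<one> (real (Suc n) * \<epsilon>)"
    then have x: "x \<in> carrier G" "d x \<one> \<le> (real n + 1) * \<epsilon>"
      by (auto simp: commute add.commute)
    let ?t = "1 / (real n + 1)"
    obtain y where y: "y \<in> carrier G" "d y \<one> \<le> ?t * d x \<one>" "d x y \<le> (1 - ?t) * d x \<one>"
      using subdivide[OF x(1), of ?t] by auto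
    have "?t * d x \<one> \<le> \<epsilon>"
      using x(2) by (simp add: field_simps)
    moreover have "(1 - ?t) * d x \<one> \<le> (1 - ?t) * ((real n + 1) * \<epsilon>)"
      by (intro mult_left_mono x(2)) auto
    moreover have "(1 - ?t) * ((real n + 1) * \<epsilon>) = real n * \<epsilon>"
      by (simp add: field_simps)
    ultimately have "y \<in> V" "x \<otimes> inv y \<in> set_power G V n"
      using V Suc y x(1) dist_mult_inv[of x y] by (auto simp: commute subset_iff)
    moreover have "x = (x \<otimes> inv y) \<otimes> y"
      using x(1) y(1) by (simp add: m_assoc)
    ultimately show "x \<in> set_power G V (Suc n)"
      unfolding set_power.simps set_mult_def by blast
  qed
qed

lemma mem_set_power:
  assumes V: "mcball \<one> \<epsilon> \<subseteq> V" and "0 < \<epsilon>" and x: "x \<in> carrier G"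
  shows "x \<in> set_power G V (nat \<lceil>d x \<one> / \<epsilon>\<rceil>)"
proof -
  have "d x \<one> / \<epsilon> \<le> real (nat \<lceil>d x \<one> / \<epsilon>\<rceil>)"
    by linarith
  then have "d x \<one> \<le> real (nat \<lceil>d x \<one> / \<epsilon>\<rceil>) * \<epsilon>"
    using \<open>0 < \<epsilon>\<close> pos_divide_le_eq by blast
  then show ?thesis
    using x by (intro subsetD[OF mcball_subset_set_power[OF V \<open>0 < \<epsilon>\<close>]])
      (simp add: commute)
qed

text \<open>
  Both metrics induce the same topology, so the unit ball of \<open>d'\<close> contains a small \<open>d\<close>-ball; a
  \<open>d\<close>-ball of any radius lies in some \<open>n\<close>-th power of that one, and the \<open>n\<close>-th power of the unit
  ball of \<open>d'\<close> has \<open>d'\<close>-radius at most \<open>n\<close>.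
\<close>

lemma mbounded_compatible_metric:
  assumes d': "right_invariant_compatible_metric G mtopology d'"
  shows "Metric_space.mbounded (carrier G) d' (mball \<one> r)"
proof -
  interpret M': right_invariant_metric_group G d'
    using d' unfolding right_invariant_compatible_metric_def
    by (intro right_invariant_metric_group.intro right_invariant_metric_group_axioms.intro
        group_axioms) auto
  have "openin mtopology (M'.mball \<one> 1)"
    using d' M'.openin_mball unfolding right_invariant_compatible_metric_def by metis
  then obtain \<epsilon> where \<epsilon>: "\<epsilon> > 0" "mcball \<one> \<epsilon> \<subseteq> M'.mball \<one> 1"
    unfolding openin_mtopology_mcball by (metis M'.centre_in_mball_iff one_closed zero_less_one)
  let ?n = "nat \<lceil>r / \<epsilon>\<rceil>"
  have "mball \<one> r \<subseteq> M'.mcball \<one> (real ?n)"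
  proof
    fix x assume x: "x \<in> mball \<one> r"
    have "r / \<epsilon> \<le> real ?n" by linarith
    then have "r \<le> real ?n * \<epsilon>"
      using \<epsilon>(1) by (simp add: pos_divide_le_eq)
    with x have "x \<in> set_power G (M'.mball \<one> 1) ?n"
      by (intro subsetD[OF mcball_subset_set_power[OF \<epsilon>(2,1)]]) simp
    then have "d' x \<one> \<le> real ?n * 1"
      by (rule M'.dist_set_power_le[rotated 2]) (auto simp: M'.commute)
    then show "x \<in> M'.mcball \<one> (real ?n)"
      using x by (simp add: M'.commute)
  qed
  then show ?thesis
    unfolding M'.mbounded_def by blast
qed

theorem open_symmetric_OB_generating_mball:
  "open_symmetric_OB_generating G mtopology (mball \<one> 1)"
  unfolding open_symmetric_OB_generating_def property_OB_def
proof (intro conjI ballI allI impI)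
  show "inv x \<in> mball \<one> 1" if "x \<in> mball \<one> 1" for x
    using that dist_inv[of x] by (simp add: commute)
  have "mcball \<one> (1/2) \<subseteq> mball \<one> 1"
    by (auto simp: subset_iff)
  then have "carrier G \<subseteq> generate G (mball \<one> 1)"
    using mem_set_power[of "1/2" "mball \<one> 1"] set_power_subset_generate
    by (meson half_gt_zero subset_iff zero_less_one)
  moreover have "generate G (mball \<one> 1) \<subseteq> carrier G"
    by (rule generate_incl) auto
  ultimately show "generate G (mball \<one> 1) = carrier G"
    by blast
qed (auto simp: mbounded_compatible_metric)

text \<open>
  A symmetric generating set need not contain the identity, and then its powers need not increase.
  But if \<open>s\<close> lies in \<open>\<Sigma>\<close> together with a ball about it, then the right translate of this ball by
  \<open>inv s\<close> is a ball about the identity and lies in \<open>\<Sigma>\<^sup>2\<close>.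
\<close>

lemma set_power_contains_mcball:
  assumes op: "openin mtopology \<Sigma>" and sym: "\<And>x. x \<in> \<Sigma> \<Longrightarrow> inv x \<in> \<Sigma>" and "\<Sigma> \<noteq> {}"
  shows "\<exists>\<epsilon>>0. mcball \<one> \<epsilon> \<subseteq> set_power G \<Sigma> 2"
proof -
  obtain s where s: "s \<in> \<Sigma>" using \<open>\<Sigma> \<noteq> {}\<close> by blast
  have \<Sigma>: "\<Sigma> \<subseteq> carrier G"
    using op openin_subset by fastforce
  obtain r where r: "r > 0" "mball s r \<subseteq> \<Sigma>"
    using op s unfolding openin_mtopology by blast
  have "x \<in> set_power G \<Sigma> 2" if "x \<in> mball \<one> r" for x
  proof -
    have "x \<otimes> s \<in> \<Sigma>" "x \<in> carrier G"
      using mball_translate[OF _ that, of s] s \<Sigma> r(2) that by (blast, simp)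
    moreover have "x = (x \<otimes> s) \<otimes> inv s"
      using \<open>x \<in> carrier G\<close> s \<Sigma> by (auto simp: m_assoc subset_iff)
    ultimately have "x \<in> \<Sigma> <#> \<Sigma>"
      using sym[OF s] unfolding set_mult_def by blast
    then show ?thesis
      using set_power_1[OF \<Sigma>] by (simp add: numeral_2_eq_2)
  qed
  moreover have "mcball \<one> (r/2) \<subseteq> mball \<one> r"
    using r(1) by (auto simp: subset_iff)
  ultimately show ?thesis
    using r(1) by (intro exI[of _ "r/2"]) auto
qed

text \<open>
  The first estimate holds because \<open>d\<close> is one of the metrics for which property (OB) makes \<open>\<Sigma>\<close>
  bounded, the second because some \<open>\<Sigma>\<^sup>m\<close> contains a ball of some radius \<open>\<epsilon>\<close>, so that \<open>\<Sigma>\<^sup>m\<^sup>n\<close>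
  contains the ball of radius \<open>n \<epsilon>\<close>.
\<close>

lemma cayley_metric_bounds:
  assumes \<Sigma>: "open_symmetric_OB_generating G mtopology \<Sigma>"
  shows "\<exists>K\<ge>1. \<forall>x\<in>carrier G. \<forall>y\<in>carrier G.
    d x y \<le> K * right_cayley_metric G \<Sigma> x y \<and> right_cayley_metric G \<Sigma> x y \<le> K * d x y + K"
proof -
  have sub: "\<Sigma> \<subseteq> carrier G" and sym: "\<And>x. x \<in> \<Sigma> \<Longrightarrow> inv x \<in> \<Sigma>"
    and op: "openin mtopology \<Sigma>" and gen: "generate G \<Sigma> = carrier G"
    and OB: "\<And>d. right_invariant_compatible_metric G mtopology d
      \<Longrightarrow> Metric_space.mbounded (carrier G) d \<Sigma>"
    using \<Sigma> unfolding open_symmetric_OB_generating_def property_OB_def by auto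
  have "right_invariant_compatible_metric G mtopology d"
    unfolding right_invariant_compatible_metric_def
    using Metric_space_axioms right_invariant by auto
  then have "mbounded \<Sigma>" by (rule OB)
  then have "mbounded (insert \<one> \<Sigma>)" by (simp add: mbounded_insert)
  then obtain R where R: "\<And>v. v \<in> \<Sigma> \<Longrightarrow> d v \<one> \<le> R"
    unfolding mbounded_alt by blast
  have word: "x \<otimes> inv y \<in> set_power G \<Sigma> (LEAST n. x \<otimes> inv y \<in> set_power G \<Sigma> n)"
    if "x \<in> carrier G" "y \<in> carrier G" for x y
  proof -
    have "x \<otimes> inv y \<in> generate G \<Sigma>" using that gen by simp
    then obtain n where "x \<otimes> inv y \<in> set_power G \<Sigma> n"
      using generate_subset_set_powers[OF sub sym] by blast
    then show ?thesis by (rule LeastI)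
  qed
  \<comment> \<open>The empty set generates the trivial group, where the power \<open>0\<close> is already everything.\<close>
  obtain m \<epsilon> where \<epsilon>: "\<epsilon> > 0" and ball: "mcball \<one> \<epsilon> \<subseteq> set_power G \<Sigma> m"
  proof (cases "\<Sigma> = {}")
    case True
    then have "carrier G = {\<one>}" using gen generate_empty by simp
    then have "mcball \<one> 1 \<subseteq> set_power G \<Sigma> 0"
      using mcball_subset_mspace[of \<one> 1] by (simp only: set_power.simps)
    then show ?thesis by (rule that[OF zero_less_one])
  next
    case False
    obtain \<epsilon> where "\<epsilon> > 0" "mcball \<one> \<epsilon> \<subseteq> set_power G \<Sigma> 2"
      using set_power_contains_mcball[OF op sym False] by blast
    then show ?thesis by (rule that)
  qed
  define K where "K = \<bar>R\<bar> + real m / \<epsilon> + real m + 1"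
  have K: "K \<ge> 1" "R \<le> K" "real m / \<epsilon> \<le> K" "real m \<le> K"
    using \<epsilon> unfolding K_def by (auto simp: add_nonneg_nonneg abs_ge_self add_increasing2 add_increasing)
  show ?thesis
  proof (intro exI[of _ K] conjI ballI)
    show "K \<ge> 1" by (fact K)
  next
    fix x y assume xy: "x \<in> carrier G" "y \<in> carrier G"
    have "d x y \<le> right_cayley_metric G \<Sigma> x y * R"
      using dist_set_power_le[OF sub R word[OF xy]] dist_mult_inv[OF xy]
      unfolding right_cayley_metric_def by simp
    also have "\<dots> \<le> right_cayley_metric G \<Sigma> x y * K"
      by (intro mult_left_mono K) (simp add: right_cayley_metric_def)
    finally show "d x y \<le> K * right_cayley_metric G \<Sigma> x y"
      by (simp add: mult.commute)
  next
    fix x y assume xy: "x \<in> carrier G" "y \<in> carrier G"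
    let ?n = "nat \<lceil>d x y / \<epsilon>\<rceil>"
    have "x \<otimes> inv y \<in> set_power G (set_power G \<Sigma> m) ?n"
      using mem_set_power[OF ball \<epsilon>, of "x \<otimes> inv y"] xy by (simp add: dist_mult_inv)
    then have "right_cayley_metric G \<Sigma> x y \<le> real (m * ?n)"
      unfolding right_cayley_metric_def set_power_mult[OF sub]
      by (intro of_nat_mono Least_le)
    also have "\<dots> \<le> real m * (d x y / \<epsilon> + 1)"
    proof -
      have "real ?n \<le> d x y / \<epsilon> + 1"
        using \<epsilon> nonneg[of x y] by (simp add: of_nat_nat)
      then show ?thesis by (simp add: mult_left_mono)
    qed
    also have "\<dots> = real m / \<epsilon> * d x y + real m"
      by (simp add: algebra_simps)
    also have "\<dots> \<le> K * d x y + K"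
      using K by (intro add_mono mult_right_mono) auto
    finally show "right_cayley_metric G \<Sigma> x y \<le> K * d x y + K" .
  qed
qed

theorem representing_metric_bounds:
  assumes d': "represents_quasi_isometry_class G mtopology d'"
  shows "\<exists>L C. L \<ge> 1 \<and> C \<ge> 0 \<and> (\<forall>x\<in>carrier G. \<forall>y\<in>carrier G.
    1 / L * d' x y - C \<le> d x y \<and> d x y \<le> L * d' x y + C)"
proof -
  obtain \<Sigma> where \<Sigma>: "open_symmetric_OB_generating G mtopology \<Sigma>"
    and q: "quasi_isometry (carrier G) (right_cayley_metric G \<Sigma>) (carrier G) d' (\<lambda>x. x)"
    using d' unfolding represents_quasi_isometry_class_def by blast
  interpret M': Metric_space "carrier G" d'
    using d' unfolding represents_quasi_isometry_class_def by blast
  let ?c = "right_cayley_metric G \<Sigma>"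
  obtain A B where AB: "A \<ge> 1" "B \<ge> 0"
    and c: "\<And>x y. \<lbrakk>x \<in> carrier G; y \<in> carrier G\<rbrakk> \<Longrightarrow> 1 / A * ?c x y - B \<le> d' x y \<and> d' x y \<le> A * ?c x y + B"
    using q unfolding quasi_isometry_def by blast
  obtain K where K: "K \<ge> 1"
    "\<And>x y. \<lbrakk>x \<in> carrier G; y \<in> carrier G\<rbrakk> \<Longrightarrow> d x y \<le> K * ?c x y"
    "\<And>x y. \<lbrakk>x \<in> carrier G; y \<in> carrier G\<rbrakk> \<Longrightarrow> ?c x y \<le> K * d x y + K"
    using cayley_metric_bounds[OF \<Sigma>] by blast
  have AK: "A * K \<ge> 1" using AB(1) K(1) by (simp add: mult_ge1_I)
  define C where "C = 1 + B + A * K * B"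
  show ?thesis
  proof (rule exI[of _ "A * K"], rule exI[of _ C], intro conjI ballI)
    show "A * K \<ge> 1" by (fact AK)
    show "C \<ge> 0" using AB(2) AK unfolding C_def by (simp add: add_nonneg_nonneg)
    fix x y assume xy: "x \<in> carrier G" "y \<in> carrier G"
    have "d' x y \<le> A * (K * d x y + K) + B"
      using c[OF xy] mult_left_mono[OF K(3)[OF xy], of A] AB(1) by linarith
    then have "d' x y \<le> A * K * d x y + A * K + B"
      by (simp add: algebra_simps)
    moreover have "B \<le> A * K * B"
      using AK AB(2) mult_right_mono[of 1 "A*K" B] by simp
    moreover have "0 \<le> A * K * (A * K * B)"
      using AK AB(2) by simp
    ultimately have "d' x y \<le> A * K * (d x y + C)"
      using AK unfolding C_def by (simp add: algebra_simps)
    then have "d' x y / (A * K) \<le> d x y + C"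
      using AK by (simp add: pos_divide_le_eq mult.commute)
    moreover have "?c x y \<le> A * (d' x y + B)"
      using c[OF xy] AB(1) by (simp add: field_simps)
    then have "K * ?c x y \<le> K * (A * (d' x y + B))"
      using K(1) by (intro mult_left_mono) auto
    then have "d x y \<le> A * K * d' x y + A * K * B"
      using K(2)[OF xy] by (simp add: algebra_simps)
    then have "d x y \<le> A * K * d' x y + C"
      using AB(2) unfolding C_def by simp
    ultimately show "1 / (A * K) * d' x y - C \<le> d x y" "d x y \<le> A * K * d' x y + C"
      by simp_all
  qed
qed

end

section \<open>Calculus on the unit interval\<close>

lemma deriv_I_eqI:
  assumes "(f has_real_derivative D) (at x within {0..1})" "x \<in> {0..1}"
  shows "deriv_I f x = D"
  unfolding deriv_I_def
  using assms vector_derivative_within_closed_interval[of 0 1 x f D]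
  by (simp add: has_real_derivative_iff_has_vector_derivative)

lemma C1_on_II:
  assumes "\<And>x. x \<in> {0..1} \<Longrightarrow> (f has_real_derivative f' x) (at x within {0..1})"
    and "continuous_on {0..1} f'"
  shows "C1_on_I f"
proof -
  have eq: "deriv_I f x = f' x" if "x \<in> {0..1}" for x
    using assms(1)[OF that] that by (rule deriv_I_eqI)
  have "continuous_on {0..1} (deriv_I f)"
    using assms(2) by (rule continuous_on_eq) (simp add: eq)
  then show ?thesis
    unfolding C1_on_I_def using assms(1) eq by metis
qed

lemma mean_value_within:
  fixes f :: "real \<Rightarrow> real"
  assumes der: "\<And>x. x \<in> {0..1} \<Longrightarrow> (f has_real_derivative f' x) (at x within {0..1})"
    and "x \<in> {0..1}" "y \<in> {0..1}" "x < y"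
  obtains z where "z \<in> {0..1}" "f y - f x = f' z * (y - x)"
proof -
  have "(f has_derivative (*) (f' z)) (at z within {x..y})" if "x \<le> z" "z \<le> y" for z
    using der[of z] that assms(2,3)
    by (auto simp: has_field_derivative_def intro: has_derivative_subset)
  then obtain z where z: "z \<in> {x<..<y}" "f y - f x = f' z * (y - x)"
    using mvt_simple[OF \<open>x < y\<close>, of f "\<lambda>z. (*) (f' z)"] by auto
  then show ?thesis
    using z(1) assms(2,3) by (intro that[OF _ z(2)]) simp
qed

lemma strict_mono_on_if_deriv_pos:
  fixes f :: "real \<Rightarrow> real"
  assumes "\<And>x. x \<in> {0..1} \<Longrightarrow> (f has_real_derivative f' x) (at x within {0..1})"
    and "\<And>x. x \<in> {0..1} \<Longrightarrow> 0 < f' x"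
  shows "strict_mono_on {0..1} f"
proof (rule strict_mono_onI)
  fix x y :: real assume xy: "x \<in> {0..1}" "y \<in> {0..1}" "x < y"
  obtain z where "z \<in> {0..1}" "f y - f x = f' z * (y - x)"
    using mean_value_within[OF assms(1) xy] .
  moreover have "f' z * (y - x) > 0" if "z \<in> {0..1}" for z
    using assms(2)[OF that] xy(3) by simp
  ultimately show "f x < f y" by fastforce
qed

text \<open>
  Derivatives are relative to \<open>S\<close>, so that the end points of an interval are covered. The
  difference quotients of the inverse at \<open>f a\<close> are the reciprocals of those of \<open>f\<close> at \<open>a\<close>, and the
  inverse is continuous by compactness.
\<close>

lemma has_real_derivative_inv_into:
  fixes f :: "real \<Rightarrow> real"
  assumes bij: "bij_betw f S S" and "compact S" and cont: "continuous_on S f"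
    and a: "a \<in> S" and der: "(f has_real_derivative D) (at a within S)" and "D \<noteq> 0"
  shows "(inv_into S f has_real_derivative inverse D) (at (f a) within S)"
proof -
  define g where "g = inv_into S f"
  have inj: "inj_on f S" and im: "f ` S = S"
    using bij by (auto simp: bij_betw_def)
  have fg: "f (g y) = y" "g y \<in> S" if "y \<in> S" for y
    using that im by (auto simp: g_def f_inv_into_f inv_into_into)
  have ga: "g (f a) = a" using a inj by (simp add: g_def)
  have "continuous_on S g"
    using continuous_on_inv[OF cont \<open>compact S\<close>, of g] inj unfolding im
    by (simp add: g_def)
  then have "(g \<longlongrightarrow> a) (at (f a) within S)"
    using a im ga unfolding continuous_on_def by (metis image_eqI)
  moreover have "\<forall>\<^sub>F y in at (f a) within S. g y \<in> S \<and> g y \<noteq> a"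
    unfolding eventually_at_filter using fg by (auto intro!: always_eventually)
  ultimately have g: "filterlim g (at a within S) (at (f a) within S)"
    by (auto simp: filterlim_at)
  have "((\<lambda>x. (f x - f a) / (x - a)) \<longlongrightarrow> D) (at a within S)"
    using der by (simp add: has_field_derivative_iff)
  from tendsto_inverse[OF filterlim_compose[OF this g] \<open>D \<noteq> 0\<close>]
  have "((\<lambda>y. inverse ((f (g y) - f a) / (g y - a))) \<longlongrightarrow> inverse D) (at (f a) within S)" .
  moreover have eq: "\<forall>\<^sub>F y in at (f a) within S.
      inverse ((f (g y) - f a) / (g y - a)) = (g y - g (f a)) / (y - f a)"
    unfolding eventually_at_filter using fg ga by (auto intro!: always_eventually)
  ultimately have "((\<lambda>y. (g y - g (f a)) / (y - f a)) \<longlongrightarrow> inverse D) (at (f a) within S)"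
    by (simp only: tendsto_cong[OF eq])
  then show ?thesis
    unfolding has_field_derivative_iff g_def .
qed

lemma continuous_on_if_deriv:
  fixes f :: "real \<Rightarrow> real"
  assumes "\<And>x. x \<in> S \<Longrightarrow> (f has_real_derivative f' x) (at x within S)"
  shows "continuous_on S f"
  using assms by (meson DERIV_continuous continuous_on_eq_continuous_within)

section \<open>The group of \<open>C\<^sup>1\<close>-diffeomorphisms\<close>

text \<open>
  Positivity of the derivative gives monotonicity by the mean value theorem and differentiability of the
  inverse by \<open>has_real_derivative_inv_into\<close>; the fixed end points give surjectivity by the
  intermediate value theorem.
\<close>

lemma Diff1I:
  assumes ext: "f \<in> extensional {0..1}" and ends: "f 0 = 0" "f 1 = 1"
    and der: "\<And>x. x \<in> {0..1} \<Longrightarrow> (f has_real_derivative f' x) (at x within {0..1})"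
    and cont': "continuous_on {0..1} f'" and pos: "\<And>x. x \<in> {0..1} \<Longrightarrow> 0 < f' x"
  shows "f \<in> Diff1"
proof -
  have mono: "strict_mono_on {0..1} f"
    using der pos by (rule strict_mono_on_if_deriv_pos)
  have cont: "continuous_on {0..1} f"
    using der by (rule continuous_on_if_deriv)
  have "f ` {0..1} = {0..1}"
  proof (intro equalityI subsetI)
    fix y assume "y \<in> f ` {0..1}"
    then obtain x where "x \<in> {0..1}" "y = f x" by blast
    then show "y \<in> {0..1}"
      using ends strict_mono_on_leD[OF mono, of 0 x] strict_mono_on_leD[OF mono, of x 1] by auto
  next
    fix y :: real assume "y \<in> {0..1}"
    then obtain x where "x \<in> {0..1}" "f x = y"
      using IVT'[of f 0 y 1] cont ends by auto
    then show "y \<in> f ` {0..1}" by blast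
  qed
  then have bij: "bij_betw f {0..1} {0..1}"
    using mono strict_mono_on_imp_inj_on by (auto simp: bij_betw_def)
  define g where "g = inv_into {0..1} f"
  have fg: "f (g y) = y" "g y \<in> {0..1}" if "y \<in> {0..1}" for y
    using bij_betw_inv_into_right[OF bij that] bij_betw_apply[OF bij_betw_inv_into[OF bij] that]
    by (simp_all only: g_def)
  have der_g: "(g has_real_derivative inverse (f' (g y))) (at y within {0..1})"
    if "y \<in> {0..1}" for y
    using has_real_derivative_inv_into[OF bij compact_Icc cont fg(2)[OF that] der[OF fg(2)[OF that]]]
      pos[OF fg(2)[OF that]] fg(1)[OF that] by (simp add: g_def)
  have "continuous_on {0..1} g"
    using der_g by (rule continuous_on_if_deriv)
  from this have "continuous_on {0..1} (\<lambda>y. inverse (f' (g y)))"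
  proof (intro continuous_on_inverse continuous_on_compose2[OF cont'] ballI)
    show "f' (g y) \<noteq> 0" if "y \<in> {0..1}" for y
      using pos[OF fg(2)[OF that]] by simp
  qed (use fg(2) in blast)+
  with der_g have "C1_on_I g"
    by (rule C1_on_II)
  moreover have "C1_on_I f"
    using der cont' by (rule C1_on_II)
  ultimately show ?thesis
    unfolding Diff1_def using ext bij mono by (simp add: g_def)
qed

lemma Diff1D:
  assumes "f \<in> Diff1"
  shows "f \<in> extensional {0..1}" "bij_betw f {0..1} {0..1}" "strict_mono_on {0..1} f"
    and "\<And>x. x \<in> {0..1} \<Longrightarrow> (f has_real_derivative deriv_I f x) (at x within {0..1})"
    and "continuous_on {0..1} (deriv_I f)"
  using assms by (auto simp: Diff1_def C1_on_I_def)

lemma Diff1_image: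
  assumes "f \<in> Diff1" "x \<in> {0..1}"
  shows "f x \<in> {0..1}"
  using Diff1D(2)[OF assms(1)] assms(2) by (rule bij_betw_apply)

lemma Diff1_endpoints:
  assumes f: "f \<in> Diff1"
  shows "f 0 = 0" "f 1 = 1"
proof -
  have im: "f ` {0..1} = {0..1}" using Diff1D(2)[OF f] by (simp add: bij_betw_def)
  have "0 \<in> f ` {0..1}" "1 \<in> f ` {0..1}" unfolding im by simp_all
  then obtain a b where ab: "a \<in> {0..1}" "f a = 0" "b \<in> {0..1}" "f b = 1"
    by (elim imageE) simp
  show "f 0 = 0"
    using strict_mono_on_leD[OF Diff1D(3)[OF f], of 0 a] ab Diff1_image[OF f, of 0] by auto
  show "f 1 = 1"
    using strict_mono_on_leD[OF Diff1D(3)[OF f], of b 1] ab Diff1_image[OF f, of 1] by auto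
qed

lemma at_within_unit_interval_nontrivial:
  "x \<in> {0..1} \<Longrightarrow> at x within {0..1::real} \<noteq> bot"
  by (metis islimpt_Icc trivial_limit_within zero_less_one)

lemma DERIV_chain_self_map:
  assumes g: "(g has_real_derivative E) (at x within S)" and "g ` S \<subseteq> S"
    and f: "(f has_real_derivative D) (at (g x) within S)"
  shows "((\<lambda>x. f (g x)) has_real_derivative D * E) (at x within S)"
  using DERIV_image_chain[OF DERIV_subset[OF f \<open>g ` S \<subseteq> S\<close>] g] by (simp add: o_def)

text \<open>
  The derivative of an increasing map is nonnegative, and it has no zero because the inverse map is
  differentiable too.
\<close>

lemma Diff1_deriv_pos:
  assumes f: "f \<in> Diff1" and x: "x \<in> {0..1}"
  shows "0 < deriv_I f x"
proof -
  define g where "g = inv_into {0..1} f"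
  have inj: "inj_on f {0..1}" and im: "f ` {0..1} = {0..1}"
    using Diff1D(2)[OF f] by (auto simp: bij_betw_def)
  have "(g has_real_derivative deriv_I g (f x)) (at (f x) within {0..1})"
    using f Diff1_image[OF f x] by (auto simp: Diff1_def C1_on_I_def g_def)
  from DERIV_chain_self_map[OF Diff1D(4)[OF f x] _ this] im
  have "((\<lambda>x. g (f x)) has_real_derivative deriv_I g (f x) * deriv_I f x) (at x within {0..1})"
    by simp
  then have "((\<lambda>x. x) has_real_derivative deriv_I g (f x) * deriv_I f x) (at x within {0..1})"
    by (rule has_field_derivative_transform_within[OF _ zero_less_one x]) (simp add: g_def inj)
  then have "deriv_I g (f x) * deriv_I f x = 1"
    using deriv_I_eqI[OF _ x] deriv_I_eqI[OF DERIV_ident x] by force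
  then have "deriv_I f x \<noteq> 0" by auto
  moreover have "0 \<le> deriv_I f x"
  proof (rule tendsto_lowerbound)
    show "((\<lambda>y. (f y - f x) / (y - x)) \<longlongrightarrow> deriv_I f x) (at x within {0..1})"
      using Diff1D(4)[OF f x] by (simp add: has_field_derivative_iff)
    have "0 \<le> (f y - f x) / (y - x)" if "y \<in> {0..1}" for y
      using strict_mono_on_leD[OF Diff1D(3)[OF f], of x y]
        strict_mono_on_leD[OF Diff1D(3)[OF f], of y x] that x
      by (cases "x \<le> y") (auto simp: divide_nonpos_nonpos)
    then show "\<forall>\<^sub>F y in at x within {0..1}. 0 \<le> (f y - f x) / (y - x)"
      by (auto simp: eventually_at_filter intro!: always_eventually)
    show "at x within {0..1} \<noteq> bot"
      using x by (rule at_within_unit_interval_nontrivial)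
  qed
  ultimately show ?thesis by simp
qed

lemma DERIV_Diff1_compose:
  assumes f: "f \<in> Diff1" and g: "g \<in> Diff1" and x: "x \<in> {0..1}"
  shows "(compose {0..1} f g has_real_derivative deriv_I f (g x) * deriv_I g x) (at x within {0..1})"
proof -
  have "g ` {0..1} \<subseteq> {0..1}" using Diff1_image[OF g] by blast
  from DERIV_chain_self_map[OF Diff1D(4)[OF g x] this Diff1D(4)[OF f Diff1_image[OF g x]]]
  show ?thesis
    by (rule has_field_derivative_transform_within[OF _ zero_less_one x]) (simp add: compose_def)
qed

lemma Diff1_compose:
  assumes f: "f \<in> Diff1" and g: "g \<in> Diff1"
  shows "compose {0..1} f g \<in> Diff1"
proof (rule Diff1I[OF compose_extensional _ _ DERIV_Diff1_compose[OF f g]])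
  show "compose {0..1} f g 0 = 0" "compose {0..1} f g 1 = 1"
    using Diff1_endpoints[OF f] Diff1_endpoints[OF g] by (auto simp: compose_def)
  have "continuous_on {0..1} g"
    using Diff1D(4)[OF g] by (rule continuous_on_if_deriv)
  then show "continuous_on {0..1} (\<lambda>x. deriv_I f (g x) * deriv_I g x)"
    using Diff1_image[OF g]
    by (intro continuous_on_mult continuous_on_compose2[OF Diff1D(5)[OF f]] Diff1D(5)[OF g]) blast+
  show "0 < deriv_I f (g x) * deriv_I g x" if "x \<in> {0..1}" for x
    using Diff1_deriv_pos[OF f Diff1_image[OF g that]] Diff1_deriv_pos[OF g that] by simp
qed

lemma DERIV_Diff1_id:
  assumes "x \<in> {0..1}"
  shows "(restrict (\<lambda>x. x) {0..1} has_real_derivative 1) (at x within {0..1})"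
  by (rule has_field_derivative_transform_within[OF DERIV_ident zero_less_one assms]) simp

lemma Diff1_id: "restrict (\<lambda>x. x) {0..1} \<in> Diff1"
  by (rule Diff1I[where f' = "\<lambda>_. 1", OF _ _ _ DERIV_Diff1_id]) simp_all

lemma Diff1_inverse:
  assumes f: "f \<in> Diff1"
  shows "restrict (inv_into {0..1} f) {0..1} \<in> Diff1"
proof -
  let ?g = "inv_into {0..1} f"
  have inj: "inj_on f {0..1}" and im: "f ` {0..1} = {0..1}"
    using Diff1D(2)[OF f] by (auto simp: bij_betw_def)
  have C1: "C1_on_I ?g" using f by (simp add: Diff1_def)
  have cont: "continuous_on {0..1} f"
    using Diff1D(4)[OF f] by (rule continuous_on_if_deriv)
  have der: "(restrict ?g {0..1} has_real_derivative deriv_I ?g y) (at y within {0..1})"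
    if "y \<in> {0..1}" for y
    by (rule has_field_derivative_transform_within[OF _ zero_less_one that, of ?g])
      (use C1 that in \<open>auto simp: C1_on_I_def\<close>)
  show ?thesis
  proof (rule Diff1I[OF _ _ _ der])
    have "?g (f 0) = 0" "?g (f 1) = 1" using inj by (auto simp: inv_into_f_f)
    then show "restrict ?g {0..1} 0 = 0" "restrict ?g {0..1} 1 = 1"
      using Diff1_endpoints[OF f] by auto
    show "continuous_on {0..1} (deriv_I ?g)" using C1 by (simp add: C1_on_I_def)
    fix y :: real assume "y \<in> {0..1}"
    then obtain x where x: "x \<in> {0..1}" "y = f x" using im by blast
    have "(?g has_real_derivative inverse (deriv_I f x)) (at y within {0..1})"
      unfolding x(2) using Diff1_deriv_pos[OF f x(1)]
      by (intro has_real_derivative_inv_into Diff1D(2)[OF f] cont x Diff1D(4)[OF f]) auto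
    then have "deriv_I ?g y = inverse (deriv_I f x)"
      using \<open>y \<in> {0..1}\<close> by (rule deriv_I_eqI)
    then show "0 < deriv_I ?g y" using Diff1_deriv_pos[OF f x(1)] by simp
  qed auto
qed

lemma carrier_Diff1_group [simp]: "carrier Diff1_group = Diff1"
  by (simp add: Diff1_group_def)

lemma mult_Diff1_group: "f \<otimes>\<^bsub>Diff1_group\<^esub> g = compose {0..1} f g"
  by (simp add: Diff1_group_def)

lemma one_Diff1_group: "\<one>\<^bsub>Diff1_group\<^esub> = restrict (\<lambda>x. x) {0..1}"
  by (simp add: Diff1_group_def)

lemma group_Diff1_group: "group Diff1_group"
proof (rule groupI)
  fix f g h assume fgh: "f \<in> carrier Diff1_group" "g \<in> carrier Diff1_group" "h \<in> carrier Diff1_group"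
  then show "f \<otimes>\<^bsub>Diff1_group\<^esub> g \<otimes>\<^bsub>Diff1_group\<^esub> h = f \<otimes>\<^bsub>Diff1_group\<^esub> (g \<otimes>\<^bsub>Diff1_group\<^esub> h)"
    using Diff1_image[of h] by (auto simp: mult_Diff1_group compose_def fun_eq_iff)
next
  fix f assume "f \<in> carrier Diff1_group"
  then have f: "f \<in> Diff1" by simp
  show "\<one>\<^bsub>Diff1_group\<^esub> \<otimes>\<^bsub>Diff1_group\<^esub> f = f"
    using Diff1_image[OF f] Diff1D(1)[OF f]
    by (auto simp: mult_Diff1_group one_Diff1_group compose_def fun_eq_iff extensional_def)
  have "compose {0..1} (restrict (inv_into {0..1} f) {0..1}) f = restrict (\<lambda>x. x) {0..1}"
    using Diff1_image[OF f] bij_betw_imp_inj_on[OF Diff1D(2)[OF f]]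
    by (auto simp: compose_def fun_eq_iff)
  then show "\<exists>g\<in>carrier Diff1_group. g \<otimes>\<^bsub>Diff1_group\<^esub> f = \<one>\<^bsub>Diff1_group\<^esub>"
    using Diff1_inverse[OF f] unfolding mult_Diff1_group one_Diff1_group by auto
qed (auto simp: mult_Diff1_group one_Diff1_group Diff1_compose Diff1_id)

section \<open>The map to the space of continuous functions\<close>

lemma mspace_C_sharp:
  "F \<in> mspace C_sharp \<longleftrightarrow> F \<in> extensional {0..1} \<and> continuous_on {0..1} F \<and> F 0 = 0"
  using compact_imp_bounded[OF compact_continuous_image[OF _ compact_Icc, of 0 1 F]]
  by (auto simp: C_sharp_def)

lemma restrict_in_C_sharp:
  assumes "continuous_on {0..1} u" "u 0 = 0"
  shows "restrict u {0..1} \<in> mspace C_sharp"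
proof -
  have "continuous_on {0..1} (restrict u {0..1})"
    using assms(1) by (rule continuous_on_eq) simp
  then show ?thesis using assms(2) by (simp add: mspace_C_sharp)
qed

lemma mdist_C_sharp_le_iff:
  assumes "F \<in> mspace C_sharp" "H \<in> mspace C_sharp"
  shows "mdist C_sharp F H \<le> a \<longleftrightarrow> (\<forall>x\<in>{0..1}. \<bar>F x - H x\<bar> \<le> a)"
  using assms cfunspace_mdist_le[of F "top_of_set {0..1}" euclidean_metric H a]
  by (simp add: C_sharp_def dist_real_def)

lemma abs_diff_le_mdist_C_sharp:
  assumes "F \<in> mspace C_sharp" "H \<in> mspace C_sharp" "x \<in> {0..1}"
  shows "\<bar>F x - H x\<bar> \<le> mdist C_sharp F H"
  using assms mdist_C_sharp_le_iff by blast

lemma Phi1_in_C_sharp: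
  assumes f: "f \<in> Diff1"
  shows "Phi1 f \<in> mspace C_sharp"
proof -
  have "continuous_on {0..1} (\<lambda>x. ln (deriv_I f x) - ln (deriv_I f 0))"
    using Diff1_deriv_pos[OF f] by (intro continuous_intros Diff1D(5)[OF f]) fastforce+
  then show ?thesis
    unfolding Phi1_def by (rule restrict_in_C_sharp) simp
qed

text \<open>
  The logarithm turns the chain rule into this cocycle identity. Because \<open>g 0 = 0\<close>, subtracting the
  value at \<open>0\<close> does not disturb it.
\<close>

lemma Phi1_compose:
  assumes f: "f \<in> Diff1" and g: "g \<in> Diff1" and x: "x \<in> {0..1}"
  shows "Phi1 (compose {0..1} f g) x = Phi1 f (g x) + Phi1 g x"
proof -
  have "ln (deriv_I (compose {0..1} f g) y) = ln (deriv_I f (g y)) + ln (deriv_I g y)"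
    if y: "y \<in> {0..1}" for y
    using Diff1_deriv_pos[OF f Diff1_image[OF g y]] Diff1_deriv_pos[OF g y]
    by (simp add: deriv_I_eqI[OF DERIV_Diff1_compose[OF f g y] y] ln_mult)
  from this[OF x] this[of 0] show ?thesis
    using x Diff1_image[OF g x] Diff1_endpoints[OF g] by (simp add: Phi1_def)
qed

lemma Phi1_id: "x \<in> {0..1} \<Longrightarrow> Phi1 (restrict (\<lambda>x. x) {0..1}) x = 0"
  by (simp add: Phi1_def deriv_I_eqI[OF DERIV_Diff1_id])

text \<open>
  \<^const>\<open>Phi1\<close> prescribes the derivative up to a constant factor, which is determined by \<open>f 1 = 1\<close>.
\<close>

lemma Phi1_surj:
  assumes F: "F \<in> mspace C_sharp"
  shows "\<exists>f\<in>Diff1. Phi1 f = F"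
proof -
  define P where "P x = integral {0..x} (\<lambda>t. exp (F t))" for x
  have cont: "continuous_on {0..1} (\<lambda>t. exp (F t))"
    using F by (auto simp: mspace_C_sharp intro: continuous_intros)
  have P: "(P has_real_derivative exp (F x)) (at x within {0..1})" if "x \<in> {0..1}" for x
    unfolding P_def using integral_has_real_derivative[OF cont that] .
  have "P 0 < P 1"
    using strict_mono_onD[OF strict_mono_on_if_deriv_pos[OF P], of 0 1] by simp
  moreover have P0: "P 0 = 0" by (simp add: P_def)
  ultimately have P1: "0 < P 1" by simp
  define f where "f = restrict (\<lambda>x. P x / P 1) {0..1}"
  have der: "(f has_real_derivative exp (F x) / P 1) (at x within {0..1})" if "x \<in> {0..1}" for x
    unfolding f_def
    by (rule has_field_derivative_transform_within[OF DERIV_cdivide[OF P[OF that]] zero_less_one that])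
      simp
  have "f \<in> Diff1"
  proof (rule Diff1I[OF _ _ _ der])
    show "continuous_on {0..1} (\<lambda>x. exp (F x) / P 1)"
      using P1 by (intro continuous_intros cont) auto
  qed (use P0 P1 in \<open>auto simp: f_def\<close>)
  moreover have "Phi1 f = F"
  proof
    fix x
    show "Phi1 f x = F x"
      using F P1 deriv_I_eqI[OF der, of x] deriv_I_eqI[OF der, of 0]
      by (auto simp: Phi1_def mspace_C_sharp extensional_def ln_div)
  qed
  ultimately show ?thesis by blast
qed

lemma Phi1_image: "Phi1 ` Diff1 = mspace C_sharp"
  using Phi1_in_C_sharp Phi1_surj by blast

section \<open>Comparison of the two metrics on diffeomorphisms\<close>

lemma Diff1_diff_mean_value:
  assumes f: "f \<in> Diff1" and g: "g \<in> Diff1" and x: "x \<in> {0<..1}"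
  obtains z where "z \<in> {0..1}" "f x - g x = (deriv_I f z - deriv_I g z) * x"
proof -
  have "((\<lambda>x. f x - g x) has_real_derivative deriv_I f y - deriv_I g y) (at y within {0..1})"
    if "y \<in> {0..1}" for y
    by (intro DERIV_diff Diff1D(4) f g that)
  then obtain z where "z \<in> {0..1}"
      "(f x - g x) - (f 0 - g 0) = (deriv_I f z - deriv_I g z) * (x - 0)"
    by (rule mean_value_within[of "\<lambda>x. f x - g x" _ 0 x]) (use x in auto)
  then show ?thesis
    using that Diff1_endpoints[OF f] Diff1_endpoints[OF g] by simp
qed

lemma value_close_if_deriv_close:
  assumes f: "f \<in> Diff1" and g: "g \<in> Diff1" and x: "x \<in> {0..1}"
    and close: "\<And>x. x \<in> {0..1} \<Longrightarrow> \<bar>deriv_I f x - deriv_I g x\<bar> \<le> e"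
  shows "\<bar>f x - g x\<bar> \<le> e"
proof (cases "x = 0")
  case True
  then show ?thesis
    using Diff1_endpoints[OF f] Diff1_endpoints[OF g] close[OF x] by simp
next
  case False
  then obtain z where z: "z \<in> {0..1}" "f x - g x = (deriv_I f z - deriv_I g z) * x"
    using Diff1_diff_mean_value[OF f g, of x] x by auto
  then have "\<bar>f x - g x\<bar> = \<bar>deriv_I f z - deriv_I g z\<bar> * x"
    using x by (simp add: abs_mult)
  also have "\<dots> \<le> e * 1"
    using close[OF z(1)] x by (intro mult_mono) auto
  finally show ?thesis by simp
qed

text \<open>
  \<^const>\<open>Phi1\<close> controls the logarithmic derivatives only up to an additive constant. This constant is small
  because \<open>f\<close> and \<open>g\<close> agree at both end points, so that their derivatives agree at some \<open>z\<close>.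
\<close>

lemma deriv_close_if_Phi1_close:
  assumes f: "f \<in> Diff1" and g: "g \<in> Diff1" and x: "x \<in> {0..1}"
    and close: "\<And>x. x \<in> {0..1} \<Longrightarrow> \<bar>Phi1 f x - Phi1 g x\<bar> \<le> e"
  shows "\<bar>deriv_I f x - deriv_I g x\<bar> \<le> deriv_I f x * (exp (2 * e) - 1)"
proof -
  obtain z where z: "z \<in> {0..1}" "deriv_I f z = deriv_I g z"
    using Diff1_diff_mean_value[OF f g, of 1] Diff1_endpoints[OF f] Diff1_endpoints[OF g] by auto
  define s where "s = ln (deriv_I g x) - ln (deriv_I f x)"
  have "s = (Phi1 f z - Phi1 g z) - (Phi1 f x - Phi1 g x)"
    using x z by (simp add: s_def Phi1_def)
  then have s: "\<bar>s\<bar> \<le> 2 * e"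
    using close[OF x] close[OF z(1)] by linarith
  have "deriv_I g x = deriv_I f x * exp s"
    using Diff1_deriv_pos[OF f x] Diff1_deriv_pos[OF g x] by (simp add: s_def exp_diff)
  then have "deriv_I f x - deriv_I g x = deriv_I f x * (1 - exp s)"
    by (simp add: right_diff_distrib)
  then have "\<bar>deriv_I f x - deriv_I g x\<bar> = deriv_I f x * \<bar>1 - exp s\<bar>"
    using Diff1_deriv_pos[OF f x] by (simp add: abs_mult)
  also have "\<bar>1 - exp s\<bar> \<le> exp (2 * e) - 1"
  proof -
    have "exp s \<le> exp (2 * e)" "1 + s \<le> exp s" "1 + 2 * e \<le> exp (2 * e)"
      using s by (auto intro: exp_ge_add_one_self)
    then show ?thesis using s by linarith
  qed
  finally show ?thesis
    using Diff1_deriv_pos[OF f x] by (simp add: mult_left_mono)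
qed

lemma Phi1_close_if_deriv_close:
  assumes f: "f \<in> Diff1" and g: "g \<in> Diff1" and x: "x \<in> {0..1}" and "0 < m"
    and m: "\<And>x. x \<in> {0..1} \<Longrightarrow> m \<le> deriv_I f x" "\<And>x. x \<in> {0..1} \<Longrightarrow> m \<le> deriv_I g x"
    and close: "\<And>x. x \<in> {0..1} \<Longrightarrow> \<bar>deriv_I f x - deriv_I g x\<bar> \<le> e"
  shows "\<bar>Phi1 f x - Phi1 g x\<bar> \<le> 2 * e / m"
proof -
  have ln_le: "ln a - ln b \<le> e / m" if "m \<le> a" "m \<le> b" "\<bar>a - b\<bar> \<le> e" for a b
  proof -
    have "ln a - ln b = ln (a / b)"
      using that \<open>0 < m\<close> by (simp add: ln_div)
    also have "\<dots> \<le> a / b - 1"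
      using that \<open>0 < m\<close> by (intro ln_le_minus_one) simp
    also have "\<dots> = (a - b) / b"
      using that \<open>0 < m\<close> by (simp add: field_simps)
    also have "\<dots> \<le> e / m"
      using that \<open>0 < m\<close> by (intro frac_le) auto
    finally show ?thesis .
  qed
  have "\<bar>ln (deriv_I f y) - ln (deriv_I g y)\<bar> \<le> e / m" if "y \<in> {0..1}" for y
    using ln_le[of "deriv_I f y" "deriv_I g y"] ln_le[of "deriv_I g y" "deriv_I f y"]
      m[OF that] close[OF that] by (simp add: abs_le_iff)
  from this[OF x] this[of 0] have "\<bar>Phi1 f x - Phi1 g x\<bar> \<le> e / m + e / m"
    using x by (simp add: Phi1_def abs_le_iff)
  then show ?thesis by simp
qed

lemma Phi1_metric_separates:
  assumes f: "f \<in> Diff1" and g: "g \<in> Diff1" and eq: "mdist C_sharp (Phi1 f) (Phi1 g) = 0"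
  shows "f = g"
proof (rule extensionalityI[OF Diff1D(1)[OF f] Diff1D(1)[OF g]])
  fix x :: real assume x: "x \<in> {0..1}"
  have "\<bar>deriv_I f x - deriv_I g x\<bar> \<le> deriv_I f x * (exp (2 * 0) - 1)" if "x \<in> {0..1}" for x
    using eq abs_diff_le_mdist_C_sharp[OF Phi1_in_C_sharp[OF f] Phi1_in_C_sharp[OF g]]
    by (intro deriv_close_if_Phi1_close[OF f g that]) auto
  then have "\<bar>deriv_I f x - deriv_I g x\<bar> \<le> 0" if "x \<in> {0..1}" for x
    using that by simp
  from value_close_if_deriv_close[OF f g x this] show "f x = g x" by simp
qed

lemma rho1_le:
  assumes "f \<in> Diff1" "g \<in> Diff1"
    and "\<And>x y. \<lbrakk>x \<in> {0..1}; y \<in> {0..1}\<rbrakk> \<Longrightarrow> \<bar>f x - g x\<bar> + \<bar>deriv_I f y - deriv_I g y\<bar> \<le> r"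
  shows "rho1 f g \<le> r"
proof -
  let ?S = "SUP x\<in>{0..1}. \<bar>f x - g x\<bar>"
  have "?S \<le> r - \<bar>deriv_I f y - deriv_I g y\<bar>" if "y \<in> {0..1}" for y
    using assms(3) that by (intro cSUP_least) (auto simp: le_diff_eq)
  then have "(SUP y\<in>{0..1}. \<bar>deriv_I f y - deriv_I g y\<bar>) \<le> r - ?S"
    by (intro cSUP_least) (auto simp: le_diff_eq add.commute)
  then show ?thesis using assms(1,2) by (simp add: rho1_def)
qed

text \<open>
  Together with \<open>rho1_le\<close> this characterises \<^const>\<open>rho1\<close> as a least upper bound, the suprema being finite by
  compactness.
\<close>

lemma le_rho1:
  assumes f: "f \<in> Diff1" and g: "g \<in> Diff1" and xy: "x \<in> {0..1}" "y \<in> {0..1}"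
  shows "\<bar>f x - g x\<bar> + \<bar>deriv_I f y - deriv_I g y\<bar> \<le> rho1 f g"
proof -
  have bdd: "bdd_above ((\<lambda>x. \<bar>u x\<bar>) ` {0..1})" if "continuous_on {0..1} u" for u :: "real \<Rightarrow> real"
    using that
    by (intro bounded_imp_bdd_above compact_imp_bounded compact_continuous_image continuous_intros)
      auto
  have "continuous_on {0..1} f" "continuous_on {0..1} g"
    using Diff1D(4)[OF f] Diff1D(4)[OF g] continuous_on_if_deriv by blast+
  then have "\<bar>f x - g x\<bar> \<le> (SUP x\<in>{0..1}. \<bar>f x - g x\<bar>)"
    by (intro cSUP_upper xy bdd continuous_intros)
  moreover have "\<bar>deriv_I f y - deriv_I g y\<bar> \<le> (SUP y\<in>{0..1}. \<bar>deriv_I f y - deriv_I g y\<bar>)"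
    by (intro cSUP_upper xy bdd continuous_intros Diff1D(5) f g)
  ultimately show ?thesis using f g by (simp add: rho1_def)
qed

lemma Metric_space_rho1: "Metric_space Diff1 rho1"
proof
  show "0 \<le> rho1 f g" for f g
  proof (cases "f \<in> Diff1 \<and> g \<in> Diff1")
    case True
    then show ?thesis using le_rho1[of f g 0 0] by simp
  qed (auto simp: rho1_def)
  show "rho1 f g = rho1 g f" for f g
    by (simp add: rho1_def abs_minus_commute)
  fix f g assume f: "f \<in> Diff1" and g: "g \<in> Diff1"
  show "rho1 f g = 0 \<longleftrightarrow> f = g"
  proof
    assume 0: "rho1 f g = 0"
    show "f = g"
    proof (rule extensionalityI[OF Diff1D(1)[OF f] Diff1D(1)[OF g]])
      show "f x = g x" if "x \<in> {0..1}" for x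
        using le_rho1[OF f g that that] 0 by simp
    qed
  qed (use g in \<open>simp add: rho1_def\<close>)
  fix h assume h: "h \<in> Diff1"
  show "rho1 f h \<le> rho1 f g + rho1 g h"
    using f h
  proof (rule rho1_le)
    fix x y :: real assume xy: "x \<in> {0..1}" "y \<in> {0..1}"
    show "\<bar>f x - h x\<bar> + \<bar>deriv_I f y - deriv_I h y\<bar> \<le> rho1 f g + rho1 g h"
      using le_rho1[OF f g xy] le_rho1[OF g h xy] by linarith
  qed
qed

lemma Metric_space_Phi1: "Metric_space Diff1 (\<lambda>f g. mdist C_sharp (Phi1 f) (Phi1 g))"
proof
  fix f g assume f: "f \<in> Diff1" and g: "g \<in> Diff1"
  show "mdist C_sharp (Phi1 f) (Phi1 g) = 0 \<longleftrightarrow> f = g"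
    using Phi1_metric_separates[OF f g] Phi1_in_C_sharp[OF g] by auto
qed (auto simp: mdist_commute intro!: mdist_triangle Phi1_in_C_sharp)

lemma openin_mtopology_if_metric_continuous:
  assumes "Metric_space M d" "Metric_space M d'"
    and cont: "\<And>x \<epsilon>. \<lbrakk>x \<in> M; 0 < \<epsilon>\<rbrakk> \<Longrightarrow> \<exists>\<delta>>0. \<forall>y\<in>M. d x y < \<delta> \<longrightarrow> d' x y < \<epsilon>"
    and U: "openin (Metric_space.mtopology M d') U"
  shows "openin (Metric_space.mtopology M d) U"
proof -
  interpret M: Metric_space M d by fact
  interpret M': Metric_space M d' by fact
  have "U \<subseteq> M" using U by (simp add: M'.openin_mtopology)
  moreover have "\<exists>\<delta>>0. M.mball x \<delta> \<subseteq> U" if x: "x \<in> U" for x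
  proof -
    obtain \<epsilon> where \<epsilon>: "\<epsilon> > 0" "M'.mball x \<epsilon> \<subseteq> U"
      using U x unfolding M'.openin_mtopology by blast
    obtain \<delta> where "\<delta> > 0" "\<forall>y\<in>M. d x y < \<delta> \<longrightarrow> d' x y < \<epsilon>"
      using cont[of x \<epsilon>] x \<open>U \<subseteq> M\<close> \<epsilon>(1) by blast
    then show ?thesis
      using \<epsilon>(2) by (intro exI[of _ \<delta>]) (auto simp: subset_iff)
  qed
  ultimately show ?thesis unfolding M.openin_mtopology by blast
qed

text \<open>
  Half the minimum of the derivative of \<open>f\<close> is a common lower bound for the derivatives near \<open>f\<close>, and \<open>ln\<close>
  is Lipschitz above it.
\<close>

lemma Phi1_metric_continuous_rho1:
  assumes f: "f \<in> Diff1" and "0 < \<epsilon>"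
  shows "\<exists>\<delta>>0. \<forall>g\<in>Diff1. rho1 f g < \<delta> \<longrightarrow> mdist C_sharp (Phi1 f) (Phi1 g) < \<epsilon>"
proof -
  obtain a where a: "a \<in> {0..1}" "\<And>x. x \<in> {0..1} \<Longrightarrow> deriv_I f a \<le> deriv_I f x"
    using continuous_attains_inf[of "{0..1}" "deriv_I f"] Diff1D(5)[OF f] by auto
  define m where "m = deriv_I f a / 2"
  have m: "0 < m" using Diff1_deriv_pos[OF f a(1)] by (simp add: m_def)
  define \<delta> where "\<delta> = min m (m * \<epsilon> / 4)"
  have "\<delta> \<le> m" by (simp add: \<delta>_def)
  have "mdist C_sharp (Phi1 f) (Phi1 g) < \<epsilon>" if g: "g \<in> Diff1" and less: "rho1 f g < \<delta>" for g
  proof -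
    have close: "\<bar>deriv_I f x - deriv_I g x\<bar> \<le> \<delta>" if "x \<in> {0..1}" for x
      using le_rho1[OF f g that that] less by linarith
    have "\<bar>Phi1 f x - Phi1 g x\<bar> \<le> 2 * \<delta> / m" if "x \<in> {0..1}" for x
    proof (rule Phi1_close_if_deriv_close[OF f g that m _ _ close])
      fix y :: real assume y: "y \<in> {0..1}"
      show "m \<le> deriv_I f y"
        using a(2)[OF y] m by (simp add: m_def)
      show "m \<le> deriv_I g y"
        using a(2)[OF y] close[OF y] \<open>\<delta> \<le> m\<close> unfolding m_def by linarith
    qed
    then have "mdist C_sharp (Phi1 f) (Phi1 g) \<le> 2 * \<delta> / m"
      by (simp add: mdist_C_sharp_le_iff Phi1_in_C_sharp f g)
    also have "\<dots> \<le> \<epsilon> / 2"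
      using m by (simp add: \<delta>_def divide_le_eq min_def)
    also have "\<dots> < \<epsilon>" using \<open>0 < \<epsilon>\<close> by simp
    finally show ?thesis .
  qed
  moreover have "\<delta> > 0" using m \<open>0 < \<epsilon>\<close> by (simp add: \<delta>_def)
  ultimately show ?thesis by blast
qed

lemma rho1_continuous_Phi1_metric:
  assumes f: "f \<in> Diff1" and "0 < \<epsilon>"
  shows "\<exists>\<delta>>0. \<forall>g\<in>Diff1. mdist C_sharp (Phi1 f) (Phi1 g) < \<delta> \<longrightarrow> rho1 f g < \<epsilon>"
proof -
  obtain b where b: "b \<in> {0..1}" "\<And>x. x \<in> {0..1} \<Longrightarrow> deriv_I f x \<le> deriv_I f b"
    using continuous_attains_sup[of "{0..1}" "deriv_I f"] Diff1D(5)[OF f] by auto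
  define M where "M = deriv_I f b"
  have M: "0 < M" using Diff1_deriv_pos[OF f b(1)] by (simp add: M_def)
  \<comment> \<open>\<open>\<delta>\<close> solves \<open>M * (exp (2 * \<delta>) - 1) = \<epsilon> / 4\<close>, the bound on the derivatives; the
    values contribute the same amount.\<close>
  define \<delta> where "\<delta> = ln (1 + \<epsilon> / (4 * M)) / 2"
  have exp_\<delta>: "M * (exp (2 * \<delta>) - 1) = \<epsilon> / 4"
    using M \<open>0 < \<epsilon>\<close> by (simp add: \<delta>_def add_pos_pos)
  have "rho1 f g < \<epsilon>" if g: "g \<in> Diff1" and less: "mdist C_sharp (Phi1 f) (Phi1 g) < \<delta>" for g
  proof -
    have "\<bar>Phi1 f x - Phi1 g x\<bar> \<le> \<delta>" if "x \<in> {0..1}" for x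
      using abs_diff_le_mdist_C_sharp[OF Phi1_in_C_sharp[OF f] Phi1_in_C_sharp[OF g] that] less
      by linarith
    note deriv_close_if_Phi1_close[OF f g _ this]
    moreover have "deriv_I f x * (exp (2 * \<delta>) - 1) \<le> \<epsilon> / 4" if "x \<in> {0..1}" for x
      unfolding exp_\<delta>[symmetric] M_def using b(2)[OF that] M \<open>0 < \<epsilon>\<close>
      by (intro mult_right_mono) (auto simp: \<delta>_def add_pos_pos)
    ultimately have deriv: "\<bar>deriv_I f x - deriv_I g x\<bar> \<le> \<epsilon> / 4" if "x \<in> {0..1}" for x
      using that by (meson order_trans)
    have "rho1 f g \<le> \<epsilon> / 4 + \<epsilon> / 4"
      by (intro rho1_le f g add_mono value_close_if_deriv_close[OF f g _ deriv] deriv)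
    then show ?thesis using \<open>0 < \<epsilon>\<close> by simp
  qed
  moreover have "\<delta> > 0" using M \<open>0 < \<epsilon>\<close> by (simp add: \<delta>_def ln_gt_zero)
  ultimately show ?thesis by blast
qed

lemma Diff1_topology_eq_Phi1:
  "Diff1_topology = Metric_space.mtopology Diff1 (\<lambda>f g. mdist C_sharp (Phi1 f) (Phi1 g))"
  unfolding Diff1_topology_def topology_eq
  using openin_mtopology_if_metric_continuous[OF Metric_space_rho1 Metric_space_Phi1
      Phi1_metric_continuous_rho1]
    openin_mtopology_if_metric_continuous[OF Metric_space_Phi1 Metric_space_rho1
      rho1_continuous_Phi1_metric]
  by blast

section \<open>The quasi-isometry\<close>

text \<open>
  The term \<open>Phi1 h\<close> of the cocycle identity cancels in the difference, and composing with the bijection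
  \<open>h\<close> does not change a supremum over the interval.
\<close>

lemma Phi1_metric_right_invariant:
  assumes f: "f \<in> Diff1" and g: "g \<in> Diff1" and h: "h \<in> Diff1"
  shows "mdist C_sharp (Phi1 (compose {0..1} f h)) (Phi1 (compose {0..1} g h)) =
    mdist C_sharp (Phi1 f) (Phi1 g)"
proof -
  have "mdist C_sharp (Phi1 (compose {0..1} f h)) (Phi1 (compose {0..1} g h)) \<le> a \<longleftrightarrow>
    mdist C_sharp (Phi1 f) (Phi1 g) \<le> a" for a
  proof -
    have "(\<forall>x\<in>{0..1}. \<bar>Phi1 (compose {0..1} f h) x - Phi1 (compose {0..1} g h) x\<bar> \<le> a) \<longleftrightarrow>
        (\<forall>x\<in>{0..1}. \<bar>Phi1 f (h x) - Phi1 g (h x)\<bar> \<le> a)"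
      by (intro ball_cong refl) (simp add: Phi1_compose f g h)
    also have "\<dots> \<longleftrightarrow> (\<forall>y\<in>h ` {0..1}. \<bar>Phi1 f y - Phi1 g y\<bar> \<le> a)"
      by simp
    also have "h ` {0..1} = {0..1}"
      using Diff1D(2)[OF h] by (simp add: bij_betw_def)
    finally show ?thesis
      by (simp add: mdist_C_sharp_le_iff Phi1_in_C_sharp Diff1_compose f g h)
  qed
  then show ?thesis by (meson order_antisym order_refl)
qed

text \<open>
  Geodesics are the lifts of the segments \<open>t \<cdot> Phi1 f\<close>.
\<close>

lemma Phi1_metric_subdivide:
  assumes f: "f \<in> Diff1" and t: "0 \<le> t" "t \<le> 1"
  defines "e \<equiv> restrict (\<lambda>x. x) {0..1}"
  shows "\<exists>h\<in>Diff1.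
    mdist C_sharp (Phi1 h) (Phi1 e) \<le> t * mdist C_sharp (Phi1 f) (Phi1 e) \<and>
    mdist C_sharp (Phi1 f) (Phi1 h) \<le> (1 - t) * mdist C_sharp (Phi1 f) (Phi1 e)"
proof -
  let ?F = "restrict (\<lambda>x. t * Phi1 f x) {0..1}"
  have "continuous_on {0..1} (\<lambda>x. t * Phi1 f x)"
    using Phi1_in_C_sharp[OF f] by (auto simp: mspace_C_sharp intro: continuous_intros)
  then have "?F \<in> mspace C_sharp"
    using Phi1_in_C_sharp[OF f] by (intro restrict_in_C_sharp) (simp_all add: mspace_C_sharp)
  then obtain h where h: "h \<in> Diff1" "Phi1 h = ?F"
    using Phi1_surj by blast
  have e: "e \<in> Diff1" unfolding e_def by (rule Diff1_id)
  let ?r = "mdist C_sharp (Phi1 f) (Phi1 e)"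
  have norm: "\<bar>Phi1 f x\<bar> \<le> ?r" if "x \<in> {0..1}" for x
    using abs_diff_le_mdist_C_sharp[OF Phi1_in_C_sharp[OF f] Phi1_in_C_sharp[OF e] that]
      Phi1_id[OF that] by (simp add: e_def)
  have "\<bar>Phi1 h x - Phi1 e x\<bar> \<le> t * ?r" if "x \<in> {0..1}" for x
    using norm[OF that] that t Phi1_id[OF that] by (simp add: h(2) e_def abs_mult mult_left_mono)
  moreover have "\<bar>Phi1 f x - Phi1 h x\<bar> \<le> (1 - t) * ?r" if "x \<in> {0..1}" for x
  proof -
    have "Phi1 f x - Phi1 h x = (1 - t) * Phi1 f x"
      using that by (simp add: h(2) algebra_simps)
    then show ?thesis using norm[OF that] t by (simp add: abs_mult mult_left_mono)
  qed
  ultimately show ?thesis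
    using h(1) by (intro bexI[of _ h]) (simp_all add: mdist_C_sharp_le_iff Phi1_in_C_sharp f e)
qed


interpretation Phi1_metric: geodesic_metric_group Diff1_group
  "\<lambda>f g. mdist C_sharp (Phi1 f) (Phi1 g)"
proof (intro geodesic_metric_group.intro right_invariant_metric_group.intro group_Diff1_group
    right_invariant_metric_group_axioms.intro geodesic_metric_group_axioms.intro)
  show "Metric_space (carrier Diff1_group) (\<lambda>f g. mdist C_sharp (Phi1 f) (Phi1 g))"
    using Metric_space_Phi1 by simp
qed (use Phi1_metric_right_invariant Phi1_metric_subdivide in
    \<open>simp_all add: mult_Diff1_group one_Diff1_group\<close>)

theorem theorem4p2:
  shows "(\<exists>\<Sigma>. open_symmetric_OB_generating Diff1_group Diff1_topology \<Sigma>) \<and>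
         (\<forall>d. represents_quasi_isometry_class Diff1_group Diff1_topology d \<longrightarrow>
              quasi_isometry (carrier Diff1_group) d (mspace C_sharp) (mdist C_sharp) Phi1)"
proof (intro conjI allI impI)
  have topology: "Diff1_topology = Phi1_metric.mtopology"
    by (simp add: Diff1_topology_eq_Phi1)
  show "\<exists>\<Sigma>. open_symmetric_OB_generating Diff1_group Diff1_topology \<Sigma>"
    using Phi1_metric.open_symmetric_OB_generating_mball unfolding topology by blast
  fix d assume "represents_quasi_isometry_class Diff1_group Diff1_topology d"
  then obtain L C where LC: "L \<ge> 1" "C \<ge> 0"
    and bounds: "\<forall>f\<in>carrier Diff1_group. \<forall>g\<in>carrier Diff1_group.
      1 / L * d f g - C \<le> mdist C_sharp (Phi1 f) (Phi1 g) \<and>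
      mdist C_sharp (Phi1 f) (Phi1 g) \<le> L * d f g + C"
    unfolding topology using Phi1_metric.representing_metric_bounds by meson
  have "\<exists>f\<in>carrier Diff1_group. mdist C_sharp F (Phi1 f) \<le> C" if "F \<in> mspace C_sharp" for F
  proof -
    obtain f where "f \<in> Diff1" "Phi1 f = F" using Phi1_surj[OF \<open>F \<in> mspace C_sharp\<close>] by blast
    then show ?thesis using \<open>F \<in> mspace C_sharp\<close> LC(2)
      by (intro bexI[of _ f]) (simp_all add: mdist_C_sharp_le_iff)
  qed
  then show "quasi_isometry (carrier Diff1_group) d (mspace C_sharp) (mdist C_sharp) Phi1"
    unfolding quasi_isometry_def using LC bounds Phi1_image by auto
qed

end
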